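(* Let $p$ be an odd prime and $n$ a positive integer. If a regular $3$-polytope of order $2^np$ has (Schläfli) type $\{k_1,k_2\}$, then $p\mid k_1$ or $p\mid k_2$. Moreover, up to duality (that is, up to interchanging $k_1$ and $k_2$), there are two types of regular $3$-polytopes of order $2^np$: there exist non-negative integers $s,t$ such that either Type (1): $k_1=2^sp$ and $k_2=2^t$; or Type (2): $k_1=2^sp$ and $k_2=2^tp$.
   Context: A string C-group of rank $3$ is a pair $(G,\{\rho_0,\rho_1,\rho_2\})$ where $G$ is a group generated by the ordered set of involutions $\rho_0,\rho_1,\rho_2$ such that $\rho_0\rho_2=\rho_2\rho_0$ (string property) and, writing $G_I=\langle \rho_i : i\in I\rangle$, one has $G_I\cap G_J=G_{I\cap J}$ for all $I,J\subseteq\{0,1,2\}$ (intersection property). Its order is $|G|$ and its (Schläfli) type is $\{o(\rho_0\rho_1),o(\rho_1\rho_2)\}$, an ordered pair. Each entry of the type is assumed to be at least $3$. Abstract regular $3$-polytopes and string C-groups of rank $3$ are the same objects: the automorphism group of a regular $3$-polytope $\mathcal P$, with the distinguished generators attached to a flag, is a string C-group of rank $3$, and conversely every string C-group of rank $3$ is the automorphism group of a regular $3$-polytope; the order and type of $\mathcal P$ are those of the string C-group. The dual is obtained by reversing the order of the generators, $(\rho_0,\rho_1,\rho_2)\mapsto(\rho_2,\rho_1,\rho_0)$, which turns type $\{k_1,k_2\}$ into $\{k_2,k_1\}$. *)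

theory Defs
  imports "HOL-Algebra.Algebra" "HOL-Computational_Algebra.Primes"
begin

(* String C-groups of rank 3, i.e. automorphism groups of regular 3-polytopes with the
   distinguished generators of a base flag; order and type of the polytope are those of
   the group.  Only the values of rho at 0, 1, 2 are relevant. *)
locale string_C_group3 = group G for G (structure) +
  fixes \<rho> :: "nat \<Rightarrow> 'a"
  assumes gens_closed: "\<rho> ` {0, 1, 2} \<subseteq> carrier G"
    and gens_generate: "generate G (\<rho> ` {0, 1, 2}) = carrier G"
    and involution: "\<And>i. i \<in> {0, 1, 2} \<Longrightarrow> \<rho> i \<noteq> \<one> \<and> \<rho> i \<otimes> \<rho> i = \<one>"
    and string_property: "\<rho> 0 \<otimes> \<rho> 2 = \<rho> 2 \<otimes> \<rho> 0"
    and intersection_property: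
      "\<And>I J. I \<subseteq> {0, 1, 2} \<Longrightarrow> J \<subseteq> {0, 1, 2} \<Longrightarrow>
        generate G (\<rho> ` I) \<inter> generate G (\<rho> ` J) = generate G (\<rho> ` (I \<inter> J))"
begin

definition schlafli_type :: "nat \<times> nat" where
  "schlafli_type = (ord (\<rho> 0 \<otimes> \<rho> 1), ord (\<rho> 1 \<otimes> \<rho> 2))"

end

end

theory Submission
  imports Defs
begin

text \<open>
  If both entries of the type were powers of two, \<open>G\<close> would be generated by involutions whose
  pairwise products all have two-power order, and the same would hold modulo the core of a Sylow
  \<open>2\<close>-subgroup \<open>S\<close>. There, an argument with a maximal intersection shows that
  distinct conjugates of \<open>S\<close> meet trivially, so by counting the remaining elements together with
  the identity form a subgroup \<open>P\<close> of order \<open>p\<close>, which is normal and self-centralizing.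
  Every involution then inverts \<open>P\<close>, so a product of two involutions centralizes \<open>P\<close>; if it has
  two-power order it is trivial. Hence all generating involutions coincide, which is absurd for a
  group of order divisible by \<open>p\<close>.
\<close>

section \<open>Fixed points of actions of groups of prime power order\<close>

text \<open>Orbit sizes divide \<open>q ^ k\<close>, so each is 1 or a multiple of \<open>q\<close>.
  Since \<open>q\<close> does not divide \<open>card E\<close>, some orbit is a single
  point.\<close>

lemma prime_power_orbit_fixpoint:
  assumes H: "group H" and q: "Factorial_Ring.prime q" and ord: "order H = q ^ k"
    and fin: "finite E" and ndvd: "\<not> q dvd card E"
    and closed: "\<And>g x. g \<in> carrier H \<Longrightarrow> x \<in> E \<Longrightarrow> act g x \<in> E"
    and one: "\<And>x. x \<in> E \<Longrightarrow> act \<one>\<^bsub>H\<^esub> x = x"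
    and mult: "\<And>g h x. g \<in> carrier H \<Longrightarrow> h \<in> carrier H \<Longrightarrow> x \<in> E \<Longrightarrow>
      act (g \<otimes>\<^bsub>H\<^esub> h) x = act g (act h x)"
  shows "\<exists>x\<in>E. \<forall>g\<in>carrier H. act g x = x"
proof -
  interpret H: group H by fact
  \<comment> \<open>Elements of \<open>Bij E\<close> are extensional, so \<open>act g\<close> has to
    be cut down to \<open>E\<close> before it can be one.\<close>
  define \<phi> where "\<phi> = (\<lambda>g. restrict (act g) E)"
  have inv1: "act (inv\<^bsub>H\<^esub> g) (act g x) = x" "act g (act (inv\<^bsub>H\<^esub> g) x) = x"
    if "g \<in> carrier H" "x \<in> E" for g x
    using that mult[of "inv\<^bsub>H\<^esub> g" g x] mult[of g "inv\<^bsub>H\<^esub> g" x] one by simp_all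
  have bij: "\<phi> g \<in> Bij E" if g: "g \<in> carrier H" for g
  proof -
    have "bij_betw (act g) E E"
      by (rule bij_betw_byWitness[where f' = "act (inv\<^bsub>H\<^esub> g)"])
        (use g inv1 closed in auto)
    then show ?thesis by (simp add: \<phi>_def Bij_def)
  qed
  have "\<phi> \<in> hom H (BijGroup E)"
  proof (rule homI)
    fix g h assume gh: "g \<in> carrier H" "h \<in> carrier H"
    show "\<phi> (g \<otimes>\<^bsub>H\<^esub> h) = \<phi> g \<otimes>\<^bsub>BijGroup E\<^esub> \<phi> h"
    proof
      fix x
      have "(\<phi> g \<otimes>\<^bsub>BijGroup E\<^esub> \<phi> h) x = compose E (\<phi> g) (\<phi> h) x"
        using bij[OF gh(1)] bij[OF gh(2)] by (simp add: BijGroup_def)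
      then show "\<phi> (g \<otimes>\<^bsub>H\<^esub> h) x = (\<phi> g \<otimes>\<^bsub>BijGroup E\<^esub> \<phi> h) x"
        using mult[OF gh] closed[OF gh(2)] by (simp add: \<phi>_def compose_def)
    qed
  qed (use bij in \<open>simp add: BijGroup_def\<close>)
  then interpret act: group_action H E \<phi>
    by (simp add: group_action_def group_hom_def group_hom_axioms_def H group_BijGroup)
  have "\<exists>orb\<in>orbits H E \<phi>. \<not> q dvd card orb"
  proof (rule ccontr)
    assume "\<not> ?thesis"
    then have "q dvd (\<Sum>orb\<in>orbits H E \<phi>. card orb)" by (intro dvd_sum) auto
    moreover have "(\<Sum>orb\<in>orbits H E \<phi>. card orb) = card E"
      using act.disjoint_sum[OF fin, of "\<lambda>_. 1 :: nat"] by simp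
    ultimately show False using ndvd by simp
  qed
  then obtain x where x: "x \<in> E" "\<not> q dvd card (orbit H \<phi> x)"
    by (auto simp: orbits_def)
  have "card (orbit H \<phi> x) dvd q ^ k"
    using act.orbit_stabilizer_theorem[OF x(1)] ord by (metis dvd_triv_left)
  then obtain i where "card (orbit H \<phi> x) = q ^ i"
    using divides_primepow_nat[OF q] by auto
  with x(2) have "card (orbit H \<phi> x) = 1" by (cases i) auto
  then have "orbit H \<phi> x = {x}"
    using act.orbit_refl[OF x(1)] by (metis card_1_singletonE singletonD)
  then have "act g x = x" if "g \<in> carrier H" for g
    using that x(1) by (auto simp: orbit_def \<phi>_def)
  then show ?thesis using x(1) by blast
qed

section \<open>Conjugates of subgroups and left translation of cosets\<close>

context group
begin

text \<open>This is x S x^-1, written as a condition on \<open>h\<close> so that membership needs no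
  witness. For a subgroup \<open>S\<close> it is the stabilizer of the coset \<open>x <# S\<close>
  under left translation; different cosets may have the same stabilizer.\<close>

definition conj_subgroup :: "'a \<Rightarrow> 'a set \<Rightarrow> 'a set" where
  "conj_subgroup x S = {h \<in> carrier G. inv x \<otimes> h \<otimes> x \<in> S}"

lemma inv_mult_cancel:
  assumes "x \<in> carrier G" "h \<in> carrier G"
  shows "inv x \<otimes> (x \<otimes> h) = h" "x \<otimes> (inv x \<otimes> h) = h"
  using assms by (simp_all flip: m_assoc)

lemma conj_cancel:
  assumes "x \<in> carrier G" "h \<in> carrier G"
  shows "inv x \<otimes> (x \<otimes> h \<otimes> inv x) \<otimes> x = h" "x \<otimes> (inv x \<otimes> h \<otimes> x) \<otimes> inv x = h"
  using assms by (simp_all add: m_assoc inv_mult_cancel)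

lemma conj_mult:
  assumes "x \<in> carrier G" "g \<in> carrier G" "h \<in> carrier G"
  shows "inv x \<otimes> (g \<otimes> h) \<otimes> x = (inv x \<otimes> g \<otimes> x) \<otimes> (inv x \<otimes> h \<otimes> x)"
  using assms by (simp add: m_assoc inv_mult_cancel)

lemma conj_conj:
  assumes "x \<in> carrier G" "y \<in> carrier G" "h \<in> carrier G"
  shows "inv (x \<otimes> y) \<otimes> h \<otimes> (x \<otimes> y) = inv y \<otimes> (inv x \<otimes> h \<otimes> x) \<otimes> y"
  using assms by (simp add: inv_mult_group m_assoc)

lemma conj_inv:
  assumes "x \<in> carrier G" "h \<in> carrier G"
  shows "inv x \<otimes> inv h \<otimes> x = inv (inv x \<otimes> h \<otimes> x)"
  using assms by (simp add: inv_mult_group m_assoc)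

lemma subgroup_conj_subgroup:
  assumes S: "subgroup S G" and x: "x \<in> carrier G"
  shows "subgroup (conj_subgroup x S) G"
proof (rule subgroupI)
  show "conj_subgroup x S \<noteq> {}"
    using x subgroup.one_closed[OF S] by (auto simp: conj_subgroup_def intro!: exI[of _ \<one>])
qed (use x subgroup.m_closed[OF S] subgroup.m_inv_closed[OF S] in
    \<open>auto simp: conj_subgroup_def conj_mult conj_inv\<close>)

lemma card_conj_subgroup:
  assumes S: "S \<subseteq> carrier G" and x: "x \<in> carrier G"
  shows "card (conj_subgroup x S) = card S"
proof (rule bij_betw_same_card)
  show "bij_betw (\<lambda>h. inv x \<otimes> h \<otimes> x) (conj_subgroup x S) S"
    by (rule bij_betw_byWitness[where f' = "\<lambda>h. x \<otimes> h \<otimes> inv x"])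
      (use assms conj_cancel in \<open>auto simp: conj_subgroup_def subset_iff\<close>)
qed

text \<open>As \<open>S\<close> contains the identity, t x lies in t x S = x S. So whatever fixes
  the coset of \<open>x\<close> lies in the conjugate of \<open>S\<close> by
  \<open>x\<close>.\<close>

lemma l_coset_eq_imp:
  assumes S: "subgroup S G" and "x \<in> carrier G" "t \<in> carrier G"
    and "t <# (x <# S) = x <# S"
  shows "inv x \<otimes> t \<otimes> x \<in> S"
proof -
  have "t \<otimes> x \<in> (t \<otimes> x) <# S"
    using assms subgroup.one_closed[OF S] by (force simp: l_coset_def)
  also have "\<dots> = x <# S"
    using assms by (simp add: lcos_m_assoc subgroup.subset)
  finally obtain s where "s \<in> S" "t \<otimes> x = x \<otimes> s" by (auto simp: l_coset_def)
  moreover have "s \<in> carrier G" using S \<open>s \<in> S\<close> by (rule subgroup.mem_carrier)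
  ultimately show ?thesis
    using assms by (simp add: m_assoc inv_mult_cancel)
qed

text \<open>\<open>T\<close> acts by left translation on the \<open>r\<close> cosets of
  \<open>S\<close> and fixes one of them because \<open>q\<close> does not divide \<open>r\<close>;
  the stabilizer of that coset is the conjugate sought. For a Sylow subgroup \<open>S\<close> this
  is the containment form of Sylow's conjugacy theorem.\<close>

lemma prime_power_subgroup_conj:
  assumes fin: "finite (carrier G)" and q: "Factorial_Ring.prime q"
    and T: "subgroup T G" "card T = q ^ k" and S: "subgroup S G"
    and ord: "order G = r * card S" and r: "\<not> q dvd r"
  shows "\<exists>x\<in>carrier G. T \<subseteq> conj_subgroup x S"
proof -
  have sub: "S \<subseteq> carrier G" using S by (rule subgroup.subset)
  have Tc: "T \<subseteq> carrier G" using T(1) by (rule subgroup.subset)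
  have pos: "card S > 0"
    using finite_subset[OF sub fin] subgroup.one_closed[OF S] by (auto simp: card_gt_0_iff)
  have "card (lcosets S) * card S = order G" using l_lagrange[OF fin S] .
  then have "card (lcosets S) = r" using ord pos by simp
  have "\<exists>C\<in>lcosets S. \<forall>t\<in>carrier (G\<lparr>carrier := T\<rparr>). (t <# C) = C"
  proof (rule prime_power_orbit_fixpoint[OF _ q])
    show "group (G\<lparr>carrier := T\<rparr>)" using T(1) by (rule subgroup_imp_group)
    show "order (G\<lparr>carrier := T\<rparr>) = q ^ k" using T(2) by (simp add: order_def)
    show "\<not> q dvd card (lcosets S)" using r \<open>card (lcosets S) = r\<close> by simp
    show "finite (lcosets S)" using fin by (simp add: LCOSETS_def)
  qed (use sub Tc in \<open>auto simp: LCOSETS_def lcos_m_assoc lcos_mult_one l_coset_subset_G m_assoc subset_iff\<close>)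
  then obtain x where x: "x \<in> carrier G" "\<forall>t\<in>T. t <# (x <# S) = x <# S"
    by (auto simp: LCOSETS_def)
  then have "T \<subseteq> conj_subgroup x S"
    using l_coset_eq_imp[OF S x(1)] Tc by (auto simp: conj_subgroup_def)
  then show ?thesis using x(1) by blast
qed

text \<open>\<open>D\<close> permutes the cosets \<open>s <# D\<close> other than \<open>D\<close> itself, and their number is \<open>-1\<close> modulo \<open>q\<close>.\<close>
lemma prime_power_normalizer_grows:
  assumes q: "Factorial_Ring.prime q" and ord: "order G = q ^ k"
    and D: "subgroup D G" "D \<noteq> carrier G"
  shows "\<exists>s\<in>carrier G - D. \<forall>d\<in>D. inv s \<otimes> d \<otimes> s \<in> D"
proof -
  have q0: "q > 0" using q prime_gt_0_nat by blast
  then have fin: "finite (carrier G)"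
    using ord order_gt_0_iff_finite by (metis zero_less_power)
  have sub: "D \<subseteq> carrier G" using D(1) by (rule subgroup.subset)
  define E where "E = lcosets D - {D}"
  have lag: "card (lcosets D) * card D = q ^ k" using l_lagrange[OF fin D(1)] ord by simp
  then obtain i where i: "card (lcosets D) = q ^ i"
    using divides_primepow_nat[OF q] by (metis dvd_triv_left)
  have "card D < order G"
    using D(2) sub fin by (simp add: order_def psubset_card_mono psubsetI)
  then have "i \<noteq> 0" using lag i ord by (cases i) auto
  have "D \<in> lcosets D" using lcos_mult_one[OF sub] by (auto simp: LCOSETS_def)
  then have "card E + 1 = q ^ i"
    using i fin card_Suc_Diff1[of "lcosets D" D] by (simp add: E_def LCOSETS_def)
  moreover have "q dvd q ^ i" using \<open>i \<noteq> 0\<close> by (simp add: dvd_power)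
  ultimately have "\<not> q dvd card E"
    using q by (metis dvd_add_right_iff nat_dvd_1_iff_1 not_prime_1)
  \<comment> \<open>Translation by an element of \<open>D\<close> is invertible and maps the coset
    \<open>D\<close> to itself, so it maps no other coset there. Hence \<open>E\<close> is stable
    under \<open>D\<close>.\<close>
  have shift: "d <# (s <# D) \<noteq> D" if "d \<in> D" "s \<in> carrier G" "s <# D \<noteq> D" for d s
  proof
    assume eq: "d <# (s <# D) = D"
    have dc: "d \<in> carrier G" using that sub by blast
    have "s <# D = inv d <# (d <# (s <# D))"
      using that dc sub by (simp add: lcos_m_assoc inv_mult_cancel flip: m_assoc)
    also have "\<dots> = D"
      using eq that(1) dc D(1) by (simp add: coset_join3 subgroup.m_inv_closed)
    finally show False using that by simp
  qed
  have "\<exists>C\<in>E. \<forall>t\<in>carrier (G\<lparr>carrier := D\<rparr>). (t <# C) = C"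
  proof (rule prime_power_orbit_fixpoint[OF _ q])
    show "group (G\<lparr>carrier := D\<rparr>)" using D(1) by (rule subgroup_imp_group)
    \<comment> \<open>The index of \<open>D\<close> is \<open>q ^ i\<close>, which leaves the
      exponent \<open>k - i\<close> for \<open>D\<close> itself.\<close>
    show "order (G\<lparr>carrier := D\<rparr>) = q ^ (k - i)"
    proof -
      have "card D dvd q ^ k" using lag by (metis dvd_triv_right)
      then obtain j where "card D = q ^ j" using divides_primepow_nat[OF q] by auto
      with lag i have "q ^ (i + j) = q ^ k" by (simp add: power_add)
      then have "i + j = k" using prime_gt_1_nat[OF q] by simp
      then show ?thesis using \<open>card D = q ^ j\<close> by (auto simp: order_def)
    qed
    show "\<not> q dvd card E" by fact
    show "finite E" using fin by (simp add: E_def LCOSETS_def)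
  next
    fix d C assume d: "d \<in> carrier (G\<lparr>carrier := D\<rparr>)" and "C \<in> E"
    then obtain s where s: "s \<in> carrier G" "C = s <# D" "s <# D \<noteq> D"
      by (auto simp: E_def LCOSETS_def)
    moreover have "d \<in> carrier G" using d sub by auto
    moreover have "d <# (s <# D) \<noteq> D" using shift[of d s] d s by simp
    ultimately show "d <# C \<in> E"
      using lcos_m_assoc[OF sub, of d s] by (auto simp: E_def LCOSETS_def)
  next
    fix C assume "C \<in> E"
    then have "C \<subseteq> carrier G" using l_coset_subset_G[OF sub] by (auto simp: E_def LCOSETS_def)
    then show "\<one>\<^bsub>G\<lparr>carrier := D\<rparr>\<^esub> <# C = C" using lcos_mult_one by simp
    fix d e assume "d \<in> carrier (G\<lparr>carrier := D\<rparr>)" "e \<in> carrier (G\<lparr>carrier := D\<rparr>)"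
    then show "(d \<otimes>\<^bsub>G\<lparr>carrier := D\<rparr>\<^esub> e) <# C = d <# (e <# C)"
      using lcos_m_assoc[OF \<open>C \<subseteq> carrier G\<close>] sub by (simp add: subset_iff)
  qed
  then obtain s where s: "s \<in> carrier G" "s <# D \<noteq> D" "\<forall>d\<in>D. d <# (s <# D) = s <# D"
    by (auto simp: E_def LCOSETS_def)
  have "s \<notin> D" using s coset_join3[OF s(1) D(1)] by blast
  then show ?thesis
    using s l_coset_eq_imp[OF D(1) s(1)] sub by blast
qed

section \<open>Subgroups of coprime orders, and normalizers\<close>

lemma card_subgroup_dvd:
  assumes "subgroup C G" "subgroup A G" "C \<subseteq> A"
  shows "card C dvd card A"
proof -
  have "card (rcosets\<^bsub>G\<lparr>carrier := A\<rparr>\<^esub> C) * card C = card A"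
    using group.lagrange[OF subgroup_imp_group[OF assms(2)] subgroup_incl[OF assms]]
    by (simp add: order_def)
  then show ?thesis by (metis dvd_triv_right)
qed

lemma coprime_subgroups_inter:
  assumes A: "subgroup A G" and B: "subgroup B G" and cop: "coprime (card A) (card B)"
    and x: "x \<in> A" "x \<in> B"
  shows "x = \<one>"
proof -
  have "subgroup (A \<inter> B) G" using A B by (rule subgroups_Inter_pair)
  then have "card (A \<inter> B) dvd card A" "card (A \<inter> B) dvd card B"
    using A B by (simp_all add: card_subgroup_dvd)
  then have "card (A \<inter> B) = 1" using cop by (meson coprime_common_divisor_nat)
  moreover have "\<one> \<in> A \<inter> B" using A B subgroup.one_closed by blast
  ultimately show ?thesis using x by (metis IntI card_1_singletonE singletonD)
qed

text \<open>\<open>A\<close> and \<open>B\<close> meet trivially, so distinct pairs have distinct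
  products. There are \<open>order G\<close> pairs, so the products exhaust the group.\<close>

lemma coprime_subgroups_factorize:
  assumes fin: "finite (carrier G)" and A: "subgroup A G" and B: "subgroup B G"
    and cop: "coprime (card A) (card B)" and ord: "card A * card B = order G"
    and g: "g \<in> carrier G"
  shows "\<exists>a\<in>A. \<exists>b\<in>B. g = a \<otimes> b"
proof -
  have Ac: "A \<subseteq> carrier G" and Bc: "B \<subseteq> carrier G" using A B subgroup.subset by blast+
  note triv = coprime_subgroups_inter[OF A B cop]
  have "inj_on (\<lambda>(a, b). a \<otimes> b) (A \<times> B)"
  proof (rule inj_onI, clarsimp)
    fix a b a' b' assume *: "a \<in> A" "b \<in> B" "a' \<in> A" "b' \<in> B" and eq: "a \<otimes> b = a' \<otimes> b'"
    have c: "a \<in> carrier G" "b \<in> carrier G" "a' \<in> carrier G" "b' \<in> carrier G"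
      using * Ac Bc by auto
    have "inv a' \<otimes> (a \<otimes> b) \<otimes> inv b = inv a' \<otimes> (a' \<otimes> b') \<otimes> inv b" using eq by simp
    moreover have "inv a' \<otimes> (a \<otimes> b) \<otimes> inv b = inv a' \<otimes> a"
      using c by (simp add: m_assoc)
    moreover have "inv a' \<otimes> (a' \<otimes> b') \<otimes> inv b = b' \<otimes> inv b"
      using c by (simp add: m_assoc[symmetric])
    ultimately have "inv a' \<otimes> a = b' \<otimes> inv b" by simp
    moreover have "inv a' \<otimes> a \<in> A" "b' \<otimes> inv b \<in> B"
      using * A B by (simp_all add: subgroup.m_closed subgroup.m_inv_closed)
    ultimately have "inv a' \<otimes> a = \<one>" "b' \<otimes> inv b = \<one>" using triv by auto
    then show "a = a' \<and> b = b'"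
      using c inv_mult_cancel(2)[of a' a] inv_equality[of b' "inv b"] by simp
  qed
  then have "card ((\<lambda>(a, b). a \<otimes> b) ` (A \<times> B)) = card (carrier G)"
    using ord by (simp add: card_image card_cartesian_product order_def)
  then have "(\<lambda>(a, b). a \<otimes> b) ` (A \<times> B) = carrier G"
    using Ac Bc fin by (intro card_subset_eq) auto
  with g have "g \<in> (\<lambda>(a, b). a \<otimes> b) ` (A \<times> B)" by simp
  then show ?thesis by auto
qed

text \<open>\<open>normalizer\<close> is a stabilizer and so asks for equality of \<open>D\<close>
  with its conjugate. For finite \<open>D\<close> an inclusion is enough, since conjugation is
  injective and an injective self-map of a finite set is onto.\<close>

lemma mem_normalizer_iff:
  assumes "finite (carrier G)" "D \<subseteq> carrier G"
  shows "g \<in> normalizer G D \<longleftrightarrow> g \<in> carrier G \<and> (\<forall>d\<in>D. inv g \<otimes> d \<otimes> g \<in> D)"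
proof (cases "g \<in> carrier G")
  case g: True
  have eq: "(g <# D) #> inv g = (\<lambda>d. g \<otimes> d \<otimes> inv g) ` D"
    by (auto simp: l_coset_def r_coset_def)
  have inj: "inj_on (\<lambda>d. inv g \<otimes> d \<otimes> g) D"
    by (rule inj_on_inverseI[where g = "\<lambda>d. g \<otimes> d \<otimes> inv g"])
      (use g assms(2) conj_cancel in auto)
  have "(\<lambda>d. g \<otimes> d \<otimes> inv g) ` D = D \<longleftrightarrow> (\<forall>d\<in>D. inv g \<otimes> d \<otimes> g \<in> D)"
  proof
    assume img: "(\<lambda>d. g \<otimes> d \<otimes> inv g) ` D = D"
    show "\<forall>d\<in>D. inv g \<otimes> d \<otimes> g \<in> D"
    proof
      fix d assume "d \<in> D"
      with img obtain e where "e \<in> D" "d = g \<otimes> e \<otimes> inv g" by blast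
      then show "inv g \<otimes> d \<otimes> g \<in> D" using conj_cancel(1)[OF g] assms(2) by auto
    qed
  next
    assume "\<forall>d\<in>D. inv g \<otimes> d \<otimes> g \<in> D"
    then have "(\<lambda>d. inv g \<otimes> d \<otimes> g) ` D = D"
      using inj finite_subset[OF assms(2,1)] by (intro endo_inj_surj) auto
    then have "(\<lambda>d. g \<otimes> d \<otimes> inv g) ` D = (\<lambda>d. g \<otimes> d \<otimes> inv g) ` (\<lambda>d. inv g \<otimes> d \<otimes> g) ` D"
      by simp
    also have "\<dots> = D"
      using conj_cancel(2)[OF g] assms(2) by (simp add: image_image subset_iff)
    finally show "(\<lambda>d. g \<otimes> d \<otimes> inv g) ` D = D" .
  qed
  then show ?thesis using g assms(2) unfolding eq[symmetric]
    by (simp add: normalizer_def stabilizer_def)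
qed (simp add: normalizer_def stabilizer_def)

end

section \<open>Groups of order \<open>q ^ m * p\<close> with a core-free Sylow
  \<open>q\<close>-subgroup\<close>

text \<open>The assumption \<open>core\<close> says that the conjugates of \<open>S\<close> have
  trivial intersection, that is, the action on the \<open>p\<close> cosets of \<open>S\<close> is
  faithful. The locale will be instantiated with a quotient by the core of a Sylow 2-subgroup;
  \<open>q\<close> stays general until \<open>not_generated_by_involutions\<close>.\<close>

locale core_free_sylow = group G for G (structure) +
  fixes p q m :: nat and S
  assumes p: "Factorial_Ring.prime p" and q: "Factorial_Ring.prime q" and pq: "p \<noteq> q"
    and ord: "order G = q ^ m * p"
    and S: "subgroup S G" and cardS: "card S = q ^ m"
    and core: "\<And>h. h \<in> carrier G \<Longrightarrow> (\<And>g. g \<in> carrier G \<Longrightarrow> h \<in> conj_subgroup g S) \<Longrightarrow> h = \<one>"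
begin

lemma fin: "finite (carrier G)"
  using ord prime_gt_0_nat[OF p] prime_gt_0_nat[OF q] by (simp flip: order_gt_0_iff_finite)

lemma coprime_pq: "coprime p (q ^ k)"
  using p q pq by (simp add: primes_coprime coprime_power_right_iff)

lemma not_q_dvd_p: "\<not> q dvd p"
  using primes_dvd_imp_eq[OF q p] pq by blast

lemma conj_S:
  assumes "x \<in> carrier G"
  shows "subgroup (conj_subgroup x S) G" "card (conj_subgroup x S) = q ^ m"
    "conj_subgroup x S \<subseteq> carrier G"
  using subgroup_conj_subgroup[OF S assms] card_conj_subgroup[OF subgroup.subset[OF S] assms] cardS
  by (simp_all add: subgroup.subset)

lemma mem_conj_S: "h \<in> conj_subgroup x S \<longleftrightarrow> h \<in> carrier G \<and> inv x \<otimes> h \<otimes> x \<in> S"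
  by (simp add: conj_subgroup_def)

text \<open>The order of \<open>T\<close> divides \<open>q ^ m * p\<close> and is coprime to
  \<open>p\<close>, so it is a power of \<open>q\<close> and the Sylow containment applies.\<close>

lemma q_subgroup_in_conj:
  assumes "subgroup T G" "\<not> p dvd card T"
  obtains x where "x \<in> carrier G" "T \<subseteq> conj_subgroup x S"
proof -
  have "card T dvd q ^ m * p"
    using card_subgroup_dvd[OF assms(1) subgroup_self subgroup.subset[OF assms(1)]] ord
    by (simp add: order_def)
  moreover have "coprime (card T) p"
    using assms(2) p by (metis coprime_commute prime_imp_coprime_nat)
  ultimately have "card T dvd q ^ m" by (simp add: coprime_dvd_mult_left_iff)
  then obtain k where "card T = q ^ k" using divides_primepow_nat[OF q] by auto
  then show ?thesis
    using prime_power_subgroup_conj[OF fin q assms(1) _ S, of k p] ord cardS not_q_dvd_p that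
    by auto
qed

text \<open>By coprimality every \<open>g\<close> factors as u s x with \<open>u\<close> in
  \<open>P\<close> and \<open>s\<close> in \<open>conj_subgroup x S\<close>. Conjugating
  \<open>d\<close> by \<open>u\<close> stays in \<open>D\<close>, then by \<open>s\<close> in
  \<open>conj_subgroup x S\<close>, then by \<open>x\<close> lands in \<open>S\<close>. So
  \<open>d\<close> lies in every conjugate of \<open>S\<close>, hence in the core.\<close>

lemma normalized_by_p_subgroup_trivial:
  assumes x: "x \<in> carrier G" and D: "D \<subseteq> conj_subgroup x S"
    and P: "subgroup P G" "card P = p"
    and norm: "\<And>u d. u \<in> P \<Longrightarrow> d \<in> D \<Longrightarrow> inv u \<otimes> d \<otimes> u \<in> D"
    and d: "d \<in> D"
  shows "d = \<one>"
proof (rule core)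
  show dc: "d \<in> carrier G" using D d by (auto simp: mem_conj_S)
  fix g assume g: "g \<in> carrier G"
  obtain u s where us: "u \<in> P" "s \<in> conj_subgroup x S" "g \<otimes> inv x = u \<otimes> s"
    using coprime_subgroups_factorize[OF fin P(1) conj_S(1)[OF x], of "g \<otimes> inv x"]
      coprime_pq P conj_S(2)[OF x] ord x g by (auto simp: mult.commute)
  have c: "u \<in> carrier G" "s \<in> carrier G"
    using us subgroup.mem_carrier[OF P(1)] by (simp_all add: mem_conj_S)
  let ?e = "inv u \<otimes> d \<otimes> u"
  have e: "?e \<in> conj_subgroup x S" using norm[OF us(1) d] D by blast
  have "g = g \<otimes> inv x \<otimes> x" using g x by (simp add: m_assoc)
  then have "inv g \<otimes> d \<otimes> g = inv (u \<otimes> (s \<otimes> x)) \<otimes> d \<otimes> (u \<otimes> (s \<otimes> x))"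
    using us(3) c x by (simp add: m_assoc)
  also have "\<dots> = inv x \<otimes> (inv s \<otimes> ?e \<otimes> s) \<otimes> x"
    using c x dc by (simp add: conj_conj)
  also have "\<dots> \<in> S"
  proof -
    have "inv s \<otimes> ?e \<otimes> s \<in> conj_subgroup x S"
      using subgroup.m_closed[OF conj_S(1)[OF x]] subgroup.m_inv_closed[OF conj_S(1)[OF x]] e us(2)
      by simp
    then show ?thesis by (simp add: mem_conj_S)
  qed
  finally show "d \<in> conj_subgroup g S" using dc by (simp add: mem_conj_S)
qed

text \<open>Cauchy's theorem, as Sylow's existence theorem with exponent 1.\<close>

lemma exists_order_p_subgroup:
  assumes N: "subgroup N G" and "p dvd card N"
  obtains P where "subgroup P G" "P \<subseteq> N" "card P = p"
proof -
  have "\<exists>H. subgroup H (G\<lparr>carrier := N\<rparr>) \<and> card H = p ^ 1"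
    by (rule sylow_thm[OF p subgroup_imp_group[OF N], of 1 "card N div p"])
      (use assms finite_subset[OF subgroup.subset[OF N] fin] in \<open>simp_all add: order_def\<close>)
  then obtain P where P: "subgroup P (G\<lparr>carrier := N\<rparr>)" "card P = p" by auto
  then show ?thesis
    using that[of P] incl_subgroup[OF N P(1)] subgroup.subset[OF P(1)] by simp
qed

text \<open>
  A maximal intersection \<open>D\<close> of two point stabilizers of the action on the cosets of \<open>S\<close> has a
  normalizer that lies in no single point stabilizer, so the order of the normalizer is divisible
  by \<open>p\<close>. A subgroup of order \<open>p\<close> permutes the cosets transitively, so \<open>D\<close> lies in the core of \<open>S\<close>.
\<close>
lemma conj_S_inter_trivial:
  assumes "x \<in> carrier G" "y \<in> carrier G" "inv x \<otimes> y \<notin> S"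
  shows "conj_subgroup x S \<inter> conj_subgroup y S = {\<one>}"
proof -
  \<comment> \<open>\<open>A\<close> holds the pairs of representatives of distinct cosets of
    \<open>S\<close>, and \<open>f\<close> measures the intersection of their stabilizers. The pair
    \<open>(a, b)\<close> chosen below maximizes \<open>f\<close>.\<close>
  define A where "A = {(x, y). x \<in> carrier G \<and> y \<in> carrier G \<and> inv x \<otimes> y \<notin> S}"
  define f where "f = (\<lambda>(x, y). card (conj_subgroup x S \<inter> conj_subgroup y S))"
  have "A \<subseteq> carrier G \<times> carrier G" by (auto simp: A_def)
  then have finA: "finite A" using fin by (meson finite_SigmaI finite_subset)
  have Axy: "(x, y) \<in> A" using assms by (simp add: A_def)
  then have "Max (f ` A) \<in> f ` A" using finA by (intro Max_in) auto
  then obtain a b where ab: "(a, b) \<in> A" "f (a, b) = Max (f ` A)" by auto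
  then have max: "f z \<le> f (a, b)" if "z \<in> A" for z using finA that by simp
  have a: "a \<in> carrier G" and b: "b \<in> carrier G" and nab: "inv a \<otimes> b \<notin> S"
    using ab by (auto simp: A_def)
  define D where "D = conj_subgroup a S \<inter> conj_subgroup b S"
  have D: "subgroup D G"
    unfolding D_def using conj_S(1) a b by (simp add: subgroups_Inter_pair)
  have Dc: "D \<subseteq> carrier G" using D by (rule subgroup.subset)
  define N where "N = normalizer G D"
  have N: "subgroup N G" unfolding N_def using Dc by (rule normalizer_imp_subgroup)
  have memN: "g \<in> N \<longleftrightarrow> g \<in> carrier G \<and> (\<forall>d\<in>D. inv g \<otimes> d \<otimes> g \<in> D)" for g
    unfolding N_def by (rule mem_normalizer_iff[OF fin Dc])
  have finc: "finite (conj_subgroup z S)" if "z \<in> carrier G" for z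
    using conj_S(3)[OF that] fin by (rule finite_subset)
  have same: "conj_subgroup u S = conj_subgroup v S"
    if "conj_subgroup u S \<subseteq> conj_subgroup v S" "u \<in> carrier G" "v \<in> carrier G" for u v
    using card_subset_eq[OF finc[OF that(3)] that(1)] conj_S(2) that by simp
  have DN: "D \<subseteq> N"
    using subgroup.m_closed[OF D] subgroup.m_inv_closed[OF D] Dc by (auto simp: memN)
  have "p dvd card N"
  proof (rule ccontr)
    assume "\<not> p dvd card N"
    then obtain z where z: "z \<in> carrier G" "N \<subseteq> conj_subgroup z S"
      using q_subgroup_in_conj[OF N] by blast
    show False
    proof (cases "conj_subgroup a S = conj_subgroup b S")
      case True
      then have Da: "D = conj_subgroup a S" by (simp add: D_def)
      with DN have "conj_subgroup a S \<subseteq> N" by simp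
      with z have Na: "N = conj_subgroup a S"
        using same[of a z] a by auto
      \<comment> \<open>Conjugation by b a^-1 carries the stabilizer at \<open>a\<close> to the one
        at \<open>b\<close>. These coincide here, so \<open>g\<close> normalizes \<open>D\<close>;
        but the normalizer is only the stabilizer at \<open>a\<close>, which puts \<open>a\<close>
        and \<open>b\<close> in one coset.\<close>
      define g where "g = b \<otimes> inv a"
      have g: "g \<in> carrier G" using a b by (simp add: g_def)
      have "inv g \<otimes> d \<otimes> g \<in> D" if "d \<in> D" for d
      proof -
        have d: "d \<in> carrier G" "inv b \<otimes> d \<otimes> b \<in> S"
          using that True by (auto simp: Da mem_conj_S)
        have "inv a \<otimes> (inv g \<otimes> d \<otimes> g) \<otimes> a = inv (g \<otimes> a) \<otimes> d \<otimes> (g \<otimes> a)"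
          using g a d by (simp add: conj_conj)
        also have "g \<otimes> a = b" using a b by (simp add: g_def m_assoc)
        finally show ?thesis using d g by (simp add: Da mem_conj_S)
      qed
      then have "g \<in> N" using g by (simp add: memN)
      then have "inv a \<otimes> g \<otimes> a \<in> S" by (simp add: Na mem_conj_S)
      moreover have "inv a \<otimes> g \<otimes> a = inv a \<otimes> b" using a b by (simp add: g_def m_assoc)
      ultimately show False using nab by simp
    next
      case False
      \<comment> \<open>\<open>D\<close> is proper in the \<open>q\<close>-group
        \<open>conj_subgroup w S\<close>, so some \<open>s\<close> outside \<open>D\<close>
        normalizes it there. Then \<open>s\<close> also lies in \<open>conj_subgroup z S\<close>,
        and the stabilizers at \<open>w\<close> and \<open>z\<close> share more than
        \<open>D\<close>. By maximality \<open>w\<close> and \<open>z\<close> represent the same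
        coset; taking \<open>w\<close> to be \<open>a\<close> and then \<open>b\<close> contradicts
        the choice of the pair.\<close>
      have eq: "inv w \<otimes> z \<in> S"
        if w: "w \<in> {a, b}" for w
      proof (rule ccontr)
        assume "inv w \<otimes> z \<notin> S"
        have wc: "w \<in> carrier G" using w a b by auto
        have sub: "D \<subseteq> conj_subgroup w S" using w by (auto simp: D_def)
        have "D \<noteq> conj_subgroup w S"
        proof
          assume "D = conj_subgroup w S"
          then have "conj_subgroup a S \<subseteq> conj_subgroup b S \<or> conj_subgroup b S \<subseteq> conj_subgroup a S"
            using w by (auto simp: D_def)
          then show False using same a b False by blast
        qed
        then obtain s where s: "s \<in> conj_subgroup w S" "s \<notin> D"
          "\<And>d. d \<in> D \<Longrightarrow> inv\<^bsub>G\<lparr>carrier := conj_subgroup w S\<rparr>\<^esub> s \<otimes> d \<otimes> s \<in> D"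
          using group.prime_power_normalizer_grows[OF subgroup_imp_group[OF conj_S(1)[OF wc]] q,
              of m D] conj_S(2)[OF wc] subgroup_incl[OF D conj_S(1)[OF wc] sub]
          by (auto simp: order_def)
        then have "s \<in> N"
          using m_inv_consistent[OF conj_S(1)[OF wc]] conj_S(3)[OF wc] by (auto simp: memN)
        then have "insert s D \<subseteq> conj_subgroup w S \<inter> conj_subgroup z S"
          using s(1) z sub DN by auto
            (use subgroup.m_closed in \<open>fail\<close>)?
        then have "card (insert s D) \<le> f (w, z)"
          using finc[OF wc] by (auto simp: f_def intro: card_mono)
        also have "\<dots> \<le> card D"
          using max[of "(w, z)"] wc z(1) \<open>inv w \<otimes> z \<notin> S\<close> by (simp add: A_def f_def D_def)
        finally show False
          using s(2) finite_subset[OF Dc fin] by simp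
      qed
      have "inv a \<otimes> b = (inv a \<otimes> z) \<otimes> inv (inv b \<otimes> z)"
        using a b z(1) by (simp add: inv_mult_group m_assoc inv_mult_cancel)
      also have "\<dots> \<in> S"
        using eq subgroup.m_closed[OF S] subgroup.m_inv_closed[OF S] by simp
      finally show False using nab by simp
    qed
  qed
  then obtain P where P: "subgroup P G" "P \<subseteq> N" "card P = p"
    using exists_order_p_subgroup[OF N] by blast
  have "d = \<one>" if "d \<in> D" for d
    by (rule normalized_by_p_subgroup_trivial[OF a _ P(1,3) _ that])
      (use P(2) memN in \<open>auto simp: D_def\<close>)
  \<comment> \<open>The maximal intersection is trivial, and its size bounds that of the given
    one.\<close>
  then have "card D \<le> 1" using card_mono[of "{\<one>}" D] by auto
  moreover have "card (conj_subgroup x S \<inter> conj_subgroup y S) \<le> card D"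
    using max[OF Axy] by (simp add: f_def D_def)
  moreover have "\<one> \<in> conj_subgroup x S \<inter> conj_subgroup y S"
    using assms subgroup.one_closed[OF conj_S(1)] by simp
  moreover have "finite (conj_subgroup x S \<inter> conj_subgroup y S)" using finc assms by simp
  ultimately show ?thesis
    using card_le_Suc0_iff_eq[of "conj_subgroup x S \<inter> conj_subgroup y S"] by auto
qed

section \<open>The subgroup of order \<open>p\<close>: normality, centralizer and action of
  involutions\<close>

lemma order_p_subgroup_inter_conj:
  assumes "subgroup P G" "card P = p" "x \<in> carrier G" "u \<in> P" "u \<in> conj_subgroup x S"
  shows "u = \<one>"
  using coprime_subgroups_inter[OF assms(1) conj_S(1)] assms coprime_pq conj_S(2) by simp

text \<open>Frobenius's count: the conjugates of \<open>S\<close> by the \<open>p\<close> elements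
  of \<open>P\<close> meet pairwise trivially, so together they have \<open>p * (q ^ m - 1)\<close>
  nontrivial elements. Exactly \<open>p\<close> elements of the group remain, and \<open>P\<close>
  is among them, so they form \<open>P\<close>.\<close>

lemma mem_conj_if_not_mem_order_p_subgroup:
  assumes P: "subgroup P G" "card P = p" and h: "h \<in> carrier G" "h \<notin> P"
  shows "\<exists>x\<in>P. h \<in> conj_subgroup x S"
proof -
  define U where "U = (\<Union>x\<in>P. conj_subgroup x S - {\<one>})"
  have Pc: "P \<subseteq> carrier G" using P(1) by (rule subgroup.subset)
  have finP: "finite P" using Pc fin by (rule finite_subset)
  have Uc: "U \<subseteq> carrier G" using conj_S(3) Pc by (auto simp: U_def)
  have finc: "finite (conj_subgroup z S)" if "z \<in> P" for z
    using conj_S(3) fin Pc that by (meson finite_subset subsetD)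
  have disj: "conj_subgroup x S \<inter> conj_subgroup y S = {\<one>}" if "x \<in> P" "y \<in> P" "x \<noteq> y" for x y
  proof (rule conj_S_inter_trivial)
    show c: "x \<in> carrier G" "y \<in> carrier G" using that Pc by auto
    show "inv x \<otimes> y \<notin> S"
    proof
      assume "inv x \<otimes> y \<in> S"
      moreover have "inv x \<otimes> y \<in> P"
        using that by (simp add: subgroup.m_closed[OF P(1)] subgroup.m_inv_closed[OF P(1)])
      ultimately have "inv x \<otimes> y = \<one>"
        using coprime_subgroups_inter[OF P(1) S] P(2) cardS coprime_pq by simp
      then show False using c that(3) inv_mult_cancel(2)[of x y] by simp
    qed
  qed
  have "card U = (\<Sum>x\<in>P. card (conj_subgroup x S - {\<one>}))"
    unfolding U_def using finP finc disj by (intro card_UN_disjoint) blast+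
  also have "\<dots> = (\<Sum>x\<in>P. q ^ m - 1)"
  proof (rule sum.cong)
    fix x assume "x \<in> P"
    then have x: "x \<in> carrier G" using Pc by auto
    then have "\<one> \<in> conj_subgroup x S" using subgroup.one_closed[OF conj_S(1)] by simp
    then show "card (conj_subgroup x S - {\<one>}) = q ^ m - 1"
      using conj_S(2)[OF x] by simp
  qed simp
  finally have "card U = p * (q ^ m - 1)" using P(2) by simp
  moreover have "card (carrier G - U) = q ^ m * p - card U"
    using card_Diff_subset[OF finite_subset[OF Uc fin] Uc] ord by (simp add: order_def)
  \<comment> \<open>This makes the truncated subtraction in \<open>q ^ m - 1\<close> a true
    one.\<close>
  moreover have "q ^ m \<ge> 1" using prime_gt_0_nat[OF q] by (simp add: Suc_le_eq)
  ultimately have "card (carrier G - U) = p" by (simp add: algebra_simps diff_mult_distrib2)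
  moreover have "P \<subseteq> carrier G - U"
    using Pc order_p_subgroup_inter_conj[OF P] by (auto simp: U_def)
  ultimately have "P = carrier G - U"
    using P(2) fin by (intro card_subset_eq) auto
  then show ?thesis using h by (auto simp: U_def)
qed

text \<open>A conjugate of \<open>u\<close> outside \<open>P\<close> would lie in a conjugate of
  \<open>S\<close>, hence so would \<open>u\<close>. But \<open>P\<close> meets these trivially, so
  \<open>u\<close> would be the identity.\<close>

lemma order_p_subgroup_conj_closed:
  assumes P: "subgroup P G" "card P = p" and u: "u \<in> P" and g: "g \<in> carrier G"
  shows "g \<otimes> u \<otimes> inv g \<in> P"
proof (rule ccontr)
  assume not: "g \<otimes> u \<otimes> inv g \<notin> P"
  have uc: "u \<in> carrier G" using P(1) u by (rule subgroup.mem_carrier)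
  obtain x where x: "x \<in> P" "g \<otimes> u \<otimes> inv g \<in> conj_subgroup x S"
    using mem_conj_if_not_mem_order_p_subgroup[OF P _ not] uc g by auto
  have xc: "x \<in> carrier G" using P(1) x(1) by (rule subgroup.mem_carrier)
  have "inv (inv g \<otimes> x) \<otimes> u \<otimes> (inv g \<otimes> x) = inv x \<otimes> (g \<otimes> u \<otimes> inv g) \<otimes> x"
    using uc g xc by (simp add: conj_conj)
  then have "u \<in> conj_subgroup (inv g \<otimes> x) S" using x uc by (simp add: mem_conj_S)
  then have "u = \<one>" using order_p_subgroup_inter_conj[OF P _ u, of "inv g \<otimes> x"] g xc by blast
  then show False using not g subgroup.one_closed[OF P(1)] by simp
qed

text \<open>If \<open>h\<close> is outside \<open>P\<close>, it fixes some coset of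
  \<open>S\<close>, and commuting with \<open>u\<close> it also fixes the translate by
  \<open>u\<close>. That is another coset, since \<open>u\<close> fixes none, so the trivial
  intersection of stabilizers forces \<open>h\<close> to be the identity.\<close>

lemma order_p_subgroup_self_centralizing:
  assumes P: "subgroup P G" "card P = p" and u: "u \<in> P" "u \<noteq> \<one>"
    and h: "h \<in> carrier G" and comm: "h \<otimes> u = u \<otimes> h"
  shows "h \<in> P"
proof (rule ccontr)
  assume not: "h \<notin> P"
  obtain x where x: "x \<in> P" "h \<in> conj_subgroup x S"
    using mem_conj_if_not_mem_order_p_subgroup[OF P h not] by auto
  have c: "x \<in> carrier G" "u \<in> carrier G"
    using P(1) x(1) u(1) by (auto intro: subgroup.mem_carrier)
  have "inv u \<otimes> h \<otimes> u = h" using comm c h by (simp add: m_assoc inv_mult_cancel)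
  then have "h \<in> conj_subgroup (u \<otimes> x) S" using x c h by (simp add: mem_conj_S conj_conj)
  moreover have "inv x \<otimes> (u \<otimes> x) \<notin> S"
  proof
    assume "inv x \<otimes> (u \<otimes> x) \<in> S"
    then have "u \<in> conj_subgroup x S" using c by (simp add: mem_conj_S m_assoc)
    then show False using order_p_subgroup_inter_conj[OF P c(1) u(1)] u(2) by simp
  qed
  ultimately have "h = \<one>" using conj_S_inter_trivial[of x "u \<otimes> x"] x c by auto
  then show False using not subgroup.one_closed[OF P(1)] by simp
qed

text \<open>The map taking \<open>u\<close> to u^-1 (t u t) sends \<open>P\<close> to itself. It is
  injective because \<open>t\<close> commutes with no nontrivial element of \<open>P\<close>, hence
  onto, and conjugation by \<open>t\<close> visibly inverts every value of it.\<close>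

lemma involution_inverts_order_p_subgroup:
  assumes P: "subgroup P G" "card P = p"
    and t: "t \<in> carrier G" "t \<otimes> t = \<one>" "t \<notin> P" and v: "v \<in> P"
  shows "t \<otimes> v = inv v \<otimes> t"
proof -
  have Pc: "P \<subseteq> carrier G" using P(1) by (rule subgroup.subset)
  have it: "inv t = t" using t by (simp add: inv_equality)
  have tt: "t \<otimes> (t \<otimes> x) = x" if "x \<in> carrier G" for x
    using that t by (simp flip: m_assoc)
  define f where "f = (\<lambda>u. inv u \<otimes> (t \<otimes> u \<otimes> t))"
  have "f u \<in> P" if "u \<in> P" for u
    using order_p_subgroup_conj_closed[OF P that t(1)] that it
    by (simp add: f_def subgroup.m_closed[OF P(1)] subgroup.m_inv_closed[OF P(1)])
  moreover have "inj_on f P"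
  proof (rule inj_onI)
    fix u w assume uw: "u \<in> P" "w \<in> P" "f u = f w"
    have c: "u \<in> carrier G" "w \<in> carrier G" using uw Pc by auto
    have eq: "w \<otimes> inv u \<otimes> (t \<otimes> u \<otimes> t) = t \<otimes> w \<otimes> t"
    proof -
      have "w \<otimes> inv u \<otimes> (t \<otimes> u \<otimes> t) = w \<otimes> f u" using c t by (simp add: f_def m_assoc)
      also have "\<dots> = t \<otimes> w \<otimes> t"
        unfolding uw(3) using c t by (simp add: f_def inv_mult_cancel)
      finally show ?thesis .
    qed
    \<comment> \<open>Equal values at \<open>u\<close> and \<open>w\<close> mean exactly that w u^-1
      commutes with \<open>t\<close>.\<close>
    have "(w \<otimes> inv u) \<otimes> t = (w \<otimes> inv u \<otimes> (t \<otimes> u \<otimes> t)) \<otimes> (t \<otimes> inv u)"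
      using c t by (simp add: m_assoc tt inv_mult_cancel)
    also have "\<dots> = t \<otimes> (w \<otimes> inv u)"
      unfolding eq using c t by (simp add: m_assoc tt)
    finally have comm: "t \<otimes> (w \<otimes> inv u) = (w \<otimes> inv u) \<otimes> t" ..
    have "w \<otimes> inv u \<in> P"
      using uw by (simp add: subgroup.m_closed[OF P(1)] subgroup.m_inv_closed[OF P(1)])
    then have "w \<otimes> inv u = \<one>"
      using order_p_subgroup_self_centralizing[OF P _ _ t(1) comm] t(3) by blast
    then show "u = w" using c inv_equality[of w "inv u"] by simp
  qed
  ultimately have "f ` P = P"
    using finite_subset[OF Pc fin] by (intro endo_inj_surj) auto
  then obtain u where u: "u \<in> P" "v = inv u \<otimes> (t \<otimes> u \<otimes> t)" using v by (auto simp: f_def)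
  then have c: "u \<in> carrier G" using Pc by auto
  show ?thesis using c t it by (simp add: u(2) inv_mult_group m_assoc tt)
qed

lemma q_power_order_in_order_p_subgroup:
  assumes P: "subgroup P G" "card P = p" and x: "x \<in> P" "x [^] (q ^ k) = \<one>"
  shows "x = \<one>"
proof -
  have xc: "x \<in> carrier G" using P(1) x(1) by (rule subgroup.mem_carrier)
  have "x [^]\<^bsub>G\<lparr>carrier := P\<rparr>\<^esub> order (G\<lparr>carrier := P\<rparr>) = \<one>\<^bsub>G\<lparr>carrier := P\<rparr>\<^esub>"
    using group.pow_order_eq_1[OF subgroup_imp_group[OF P(1)]] x(1) by simp
  then have "x [^] p = \<one>" using P(2) by (simp add: order_def flip: nat_pow_consistent)
  then have "ord x dvd p" "ord x dvd q ^ k" using x(2) xc by (simp_all add: pow_eq_id)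
  then have "ord x = 1" using coprime_pq by (meson coprime_common_divisor_nat)
  then show ?thesis using ord_eq_1[OF xc] by blast
qed

text \<open>Only x x = 1 is required of the elements of \<open>Y\<close>, because an involution may
  become trivial in a quotient. Two nontrivial elements of \<open>Y\<close> both invert
  \<open>P\<close>, so their product centralizes \<open>P\<close> and lies in it; having two-power
  order, it is trivial. Thus \<open>Y\<close> has at most one nontrivial element.\<close>

lemma not_generated_by_involutions:
  assumes q2: "q = 2" and Y: "Y \<subseteq> carrier G"
    and inv: "\<And>x. x \<in> Y \<Longrightarrow> x \<otimes> x = \<one>"
    and two: "\<And>x y. x \<in> Y \<Longrightarrow> y \<in> Y \<Longrightarrow> \<exists>k. (x \<otimes> y) [^] ((2::nat) ^ k) = \<one>"
  shows "generate G Y \<noteq> carrier G"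
proof
  assume gen: "generate G Y = carrier G"
  have "p dvd card (carrier G)" using ord by (simp add: order_def)
  then obtain P where P: "subgroup P G" "card P = p"
    using exists_order_p_subgroup[OF subgroup_self] by blast
  have Pc: "P \<subseteq> carrier G" using P(1) by (rule subgroup.subset)
  have "\<not> P \<subseteq> {\<one>}"
    using card_mono[of "{\<one>}" P] P(2) prime_gt_1_nat[OF p] by auto
  then obtain u where u: "u \<in> P" "u \<noteq> \<one>" by auto
  have uc: "u \<in> carrier G" using u Pc by auto
  have notP: "x \<notin> P" if "x \<in> carrier G" "x \<otimes> x = \<one>" "x \<noteq> \<one>" for x
    using q_power_order_in_order_p_subgroup[OF P, of x 1] that q2
    by (auto simp: numeral_2_eq_2)
  have eq: "x = y" if xy: "x \<in> Y" "y \<in> Y" "x \<noteq> \<one>" "y \<noteq> \<one>" for x y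
  proof -
    have c: "x \<in> carrier G" "y \<in> carrier G" using xy Y by auto
    have nP: "x \<notin> P" "y \<notin> P" using notP inv xy c by auto
    have "x \<otimes> y \<otimes> u = x \<otimes> (inv u \<otimes> y)"
      using involution_inverts_order_p_subgroup[OF P c(2) inv[OF xy(2)] nP(2) u(1)] c uc
      by (simp add: m_assoc)
    also have "\<dots> = u \<otimes> (x \<otimes> y)"
      using involution_inverts_order_p_subgroup[OF P c(1) inv[OF xy(1)] nP(1), of "inv u"] c uc u(1)
      by (simp add: subgroup.m_inv_closed[OF P(1)] flip: m_assoc)
    finally have "x \<otimes> y \<in> P"
      using order_p_subgroup_self_centralizing[OF P u] c by simp
    then have "x \<otimes> y = \<one>"
      using q_power_order_in_order_p_subgroup[OF P] two[OF xy(1,2)] q2 by blast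
    then have "x = inv y" using c by (simp add: inv_equality)
    moreover have "inv y = y" using c inv[OF xy(2)] by (simp add: inv_equality)
    ultimately show ?thesis by simp
  qed
  \<comment> \<open>If \<open>Y\<close> has no nontrivial element, \<open>t\<close> is taken to be
    the identity.\<close>
  obtain t where t: "t \<in> carrier G" "t \<otimes> t = \<one>" "Y \<subseteq> {\<one>, t}"
  proof (cases "Y \<subseteq> {\<one>}")
    case True
    then show ?thesis using that[of \<one>] by auto
  next
    case False
    then obtain t where "t \<in> Y" "t \<noteq> \<one>" by auto
    then show ?thesis using that[of t] eq inv Y by blast
  qed
  have "subgroup {\<one>, t} G"
    by (rule subgroupI) (use t in \<open>auto simp: inv_equality\<close>)
  then have "carrier G \<subseteq> {\<one>, t}"
    using generate_subgroup_incl[OF t(3)] gen by simp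
  \<comment> \<open>The whole group has at most the elements 1 and \<open>t\<close>, so the
    nontrivial \<open>u\<close> in \<open>P\<close> is \<open>t\<close>, although no nontrivial
    element squaring to 1 lies in \<open>P\<close>.\<close>
  then have "u = t" using u uc by auto
  then show False using notP[of t] t u by simp
qed

end

section \<open>Reduction modulo the core of a Sylow 2-subgroup\<close>

context group
begin

text \<open>Conjugation permutes the conjugates of \<open>S\<close>: the condition on x h x^-1 at
  \<open>g\<close> is the condition on \<open>h\<close> at x^-1 g.\<close>

lemma normal_core:
  assumes S: "subgroup S G"
  shows "{h \<in> carrier G. \<forall>g\<in>carrier G. h \<in> conj_subgroup g S} \<lhd> G" (is "?K \<lhd> G")
proof (rule normal_invI)
  show "subgroup ?K G"
  proof (rule subgroupI)
    have "\<one> \<in> ?K" using subgroup.one_closed[OF subgroup_conj_subgroup[OF S]] by simp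
    then show "?K \<noteq> {}" by blast
  qed (use subgroup.m_closed[OF subgroup_conj_subgroup[OF S]]
        subgroup.m_inv_closed[OF subgroup_conj_subgroup[OF S]] in auto)
  fix x h assume x: "x \<in> carrier G" and h: "h \<in> ?K"
  then have hc: "h \<in> carrier G" by simp
  have "x \<otimes> h \<otimes> inv x \<in> conj_subgroup g S" if g: "g \<in> carrier G" for g
  proof -
    have "inv (inv x \<otimes> g) \<otimes> h \<otimes> (inv x \<otimes> g) \<in> S"
      using h x g by (auto simp: conj_subgroup_def)
    also have "inv (inv x \<otimes> g) \<otimes> h \<otimes> (inv x \<otimes> g) = inv g \<otimes> (x \<otimes> h \<otimes> inv x) \<otimes> g"
      using x g hc by (simp add: conj_conj)
    finally show ?thesis using x g hc by (simp add: conj_subgroup_def)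
  qed
  then show "x \<otimes> h \<otimes> inv x \<in> ?K" using x hc by simp
qed

lemma not_generated_by_involutions_of_two_power_products:
  assumes p: "Factorial_Ring.prime p" "odd p" and ord: "order G = 2 ^ n * p"
    and Y: "Y \<subseteq> carrier G"
    and invol: "\<And>x. x \<in> Y \<Longrightarrow> x \<otimes> x = \<one>"
    and two: "\<And>x y. x \<in> Y \<Longrightarrow> y \<in> Y \<Longrightarrow> \<exists>k. (x \<otimes> y) [^] ((2::nat) ^ k) = \<one>"
  shows "generate G Y \<noteq> carrier G"
proof
  assume gen: "generate G Y = carrier G"
  have q: "Factorial_Ring.prime (2 :: nat)" by simp
  have fin: "finite (carrier G)"
    using ord prime_gt_0_nat[OF p(1)] by (simp flip: order_gt_0_iff_finite)
  obtain S where S: "subgroup S G" "card S = 2 ^ n"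
    using sylow_thm[OF q is_group ord fin] by blast
  define K where "K = {h \<in> carrier G. \<forall>g\<in>carrier G. h \<in> conj_subgroup g S}"
  interpret K: normal K G unfolding K_def by (rule normal_core[OF S(1)])
  have Kg: "subgroup K G" by (rule K.is_subgroup)
  have KS: "K \<subseteq> S"
  proof
    fix h assume "h \<in> K"
    then have "h \<in> conj_subgroup \<one> S" unfolding K_def using one_closed by blast
    then show "h \<in> S" by (auto simp: conj_subgroup_def)
  qed
  let ?Q = "G Mod K"
  define \<pi> where "\<pi> = (\<lambda>x. K #> x)"
  interpret pi: group_hom G ?Q \<pi>
    by (simp add: group_hom_def group_hom_axioms_def is_group K.factorgroup_is_group
        K.r_coset_hom_Mod \<pi>_def)
  have surj: "\<pi> ` carrier G = carrier ?Q"
    by (auto simp: \<pi>_def FactGroup_def RCOSETS_def)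
  \<comment> \<open>As \<open>K\<close> lies in \<open>S\<close>, the subgroup \<open>S\<close> is a
    union of cosets of \<open>K\<close>, so membership in \<open>S\<close> can be tested in the
    quotient.\<close>
  have mem_S: "x \<in> S" if x: "x \<in> carrier G" and px: "\<pi> x \<in> \<pi> ` S" for x
  proof -
    obtain s where s: "s \<in> S" "K #> x = K #> s" using px by (auto simp: \<pi>_def)
    have "x \<in> K #> s" using rcos_self[OF x Kg] s(2) by simp
    then obtain k where "k \<in> K" "x = k \<otimes> s" by (auto simp: r_coset_def)
    then show "x \<in> S" using s(1) KS by (auto simp: subgroup.m_closed[OF S(1)])
  qed
  have cards: "card (\<pi> ` S) * card K = 2 ^ n" "order ?Q * card K = 2 ^ n * p"
  proof -
    have "card (rcosets\<^bsub>G\<lparr>carrier := S\<rparr>\<^esub> K) * card K = 2 ^ n"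
      using group.lagrange[OF subgroup_imp_group[OF S(1)] subgroup_incl[OF Kg S(1) KS]] S(2)
      by (simp add: order_def)
    moreover have "rcosets\<^bsub>G\<lparr>carrier := S\<rparr>\<^esub> K = \<pi> ` S"
      by (auto simp: RCOSETS_def \<pi>_def r_coset_def)
    ultimately show "card (\<pi> ` S) * card K = 2 ^ n" by simp
    show "order ?Q * card K = 2 ^ n * p"
      using lagrange[OF Kg] ord by (simp add: order_def FactGroup_def)
  qed
  then obtain m where m: "card (\<pi> ` S) = 2 ^ m"
    using divides_primepow_nat[OF q] by (metis dvd_triv_left)
  have "card K > 0" using cards(1) by (cases "card K") auto
  moreover have "order ?Q * card K = (2 ^ m * p) * card K"
    using cards m by (simp add: mult_ac)
  ultimately have ordQ: "order ?Q = 2 ^ m * p" by simp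
  interpret Q: core_free_sylow ?Q p 2 m "\<pi> ` S"
  proof (intro core_free_sylow.intro core_free_sylow_axioms.intro)
    show "group ?Q" by (rule K.factorgroup_is_group)
    show "Factorial_Ring.prime p" by fact
    show "Factorial_Ring.prime (2 :: nat)" by fact
    show "p \<noteq> 2" using p(2) by auto
    show "order ?Q = 2 ^ m * p" by fact
    show "subgroup (\<pi> ` S) ?Q" using S(1) by (rule pi.subgroup_img_is_subgroup)
    show "card (\<pi> ` S) = 2 ^ m" by fact
    fix h assume h: "h \<in> carrier ?Q"
      and all: "\<And>g. g \<in> carrier ?Q \<Longrightarrow> h \<in> group.conj_subgroup ?Q g (\<pi> ` S)"
    obtain x where x: "x \<in> carrier G" "h = \<pi> x" using h surj by auto
    \<comment> \<open>Lying in all conjugates of the image of \<open>S\<close> pulls back to lying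
      in all conjugates of \<open>S\<close>, that is, in \<open>K\<close>.\<close>
    have "x \<in> conj_subgroup g S" if g: "g \<in> carrier G" for g
    proof -
      have "inv\<^bsub>?Q\<^esub> \<pi> g \<otimes>\<^bsub>?Q\<^esub> \<pi> x \<otimes>\<^bsub>?Q\<^esub> \<pi> g \<in> \<pi> ` S"
        using all[of "\<pi> g"] g x by (simp add: pi.H.conj_subgroup_def)
      then have "\<pi> (inv g \<otimes> x \<otimes> g) \<in> \<pi> ` S" using g x by simp
      then show ?thesis using mem_S g x by (simp add: conj_subgroup_def)
    qed
    then have "x \<in> K" using x(1) unfolding K_def by blast
    then show "h = \<one>\<^bsub>?Q\<^esub>" using x coset_join2[OF x(1) Kg] by (simp add: \<pi>_def)
  qed
  have "generate ?Q (\<pi> ` Y) \<noteq> carrier ?Q"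
  proof (rule Q.not_generated_by_involutions)
    show "\<pi> ` Y \<subseteq> carrier ?Q" using Y by auto
    fix x assume "x \<in> \<pi> ` Y"
    then obtain a where a: "a \<in> Y" "x = \<pi> a" by auto
    have ac: "a \<in> carrier G" using a Y by auto
    have "\<pi> (a \<otimes> a) = \<one>\<^bsub>?Q\<^esub>" unfolding invol[OF a(1)] by (rule pi.hom_one)
    then show "x \<otimes>\<^bsub>?Q\<^esub> x = \<one>\<^bsub>?Q\<^esub>" using ac a(2) by (simp del: mult_FactGroup one_FactGroup)
    fix y assume "y \<in> \<pi> ` Y"
    then obtain b where b: "b \<in> Y" "y = \<pi> b" by auto
    have bc: "b \<in> carrier G" using b Y by auto
    obtain k where k: "(a \<otimes> b) [^] ((2::nat) ^ k) = \<one>" using two a b by blast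
    have "\<pi> ((a \<otimes> b) [^] ((2::nat) ^ k)) = \<one>\<^bsub>?Q\<^esub>" unfolding k by (rule pi.hom_one)
    then have "(x \<otimes>\<^bsub>?Q\<^esub> y) [^]\<^bsub>?Q\<^esub> ((2::nat) ^ k) = \<one>\<^bsub>?Q\<^esub>"
      using ac bc a(2) b(2) by (simp add: pi.hom_nat_pow del: mult_FactGroup one_FactGroup)
    then show "\<exists>k. (x \<otimes>\<^bsub>?Q\<^esub> y) [^]\<^bsub>?Q\<^esub> ((2::nat) ^ k) = \<one>\<^bsub>?Q\<^esub>" ..
  qed simp
  moreover have "generate ?Q (\<pi> ` Y) = carrier ?Q"
    using pi.generate_img[OF Y] gen surj by simp
  ultimately show False by simp
qed

end

section \<open>The possible types\<close>

lemma dvd_two_power_mult_prime: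
  fixes p :: nat
  assumes "Factorial_Ring.prime p" "k dvd 2 ^ n * p"
  obtains s where "k = 2 ^ s" | s where "k = 2 ^ s * p"
proof (cases "p dvd k")
  case True
  then obtain c where c: "k = c * p" by (metis dvdE mult.commute)
  then have "c dvd 2 ^ n" using assms prime_gt_0_nat by simp
  then show ?thesis using divides_primepow_nat[of 2 c n] c that(2) by auto
next
  case False
  then have "coprime k p" using assms(1) by (metis coprime_commute prime_imp_coprime_nat)
  then have "k dvd 2 ^ n" using assms(2) by (simp add: coprime_dvd_mult_left_iff)
  then show ?thesis using divides_primepow_nat[of 2 k n] that(1) by auto
qed

theorem theorem1p2:
  fixes G :: "('a, 'b) monoid_scheme" and \<rho> :: "nat \<Rightarrow> 'a" and p n k1 k2 :: nat
  assumes "Factorial_Ring.prime p" and "odd p" and "n > 0"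
    and "string_C_group3 G \<rho>"
    and "order G = 2 ^ n * p"
    and "string_C_group3.schlafli_type G \<rho> = (k1, k2)"
    and "k1 \<ge> 3" and "k2 \<ge> 3"
  shows "(p dvd k1 \<or> p dvd k2) \<and>
    (\<exists>a b s t. ((a, b) = (k1, k2) \<or> (a, b) = (k2, k1)) \<and>
      ((a = 2 ^ s * p \<and> b = 2 ^ t) \<or> (a = 2 ^ s * p \<and> b = 2 ^ t * p)))"
proof -
  interpret string_C_group3 G \<rho> by fact
  have k: "k1 = ord (\<rho> 0 \<otimes>\<^bsub>G\<^esub> \<rho> 1)" "k2 = ord (\<rho> 1 \<otimes>\<^bsub>G\<^esub> \<rho> 2)"
    using assms(6) by (simp_all add: schlafli_type_def)
  have c: "\<rho> 0 \<in> carrier G" "\<rho> 1 \<in> carrier G" "\<rho> 2 \<in> carrier G"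
    using gens_closed by auto
  have invol: "x \<otimes>\<^bsub>G\<^esub> x = \<one>\<^bsub>G\<^esub>" if "x \<in> \<rho> ` {0, 1, 2}" for x
    using that involution by blast
  have "k1 dvd 2 ^ n * p" "k2 dvd 2 ^ n * p"
    using ord_dvd_group_order c assms(5) by (metis k m_closed)+
  then have k_cases: "(\<exists>s. k1 = 2 ^ s) \<or> (\<exists>s. k1 = 2 ^ s * p)"
    "(\<exists>s. k2 = 2 ^ s) \<or> (\<exists>s. k2 = 2 ^ s * p)"
    using dvd_two_power_mult_prime[OF assms(1)] by metis+
  have "\<not> ((\<exists>s. k1 = 2 ^ s) \<and> (\<exists>t. k2 = 2 ^ t))"
  proof
    assume "(\<exists>s. k1 = 2 ^ s) \<and> (\<exists>t. k2 = 2 ^ t)"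
    then obtain s t where st: "k1 = 2 ^ s" "k2 = 2 ^ t" by blast
    define T where "T x \<longleftrightarrow> (\<exists>k. x [^]\<^bsub>G\<^esub> ((2::nat) ^ k) = \<one>\<^bsub>G\<^esub>)" for x
    have T01: "T (\<rho> 0 \<otimes>\<^bsub>G\<^esub> \<rho> 1)" and T12: "T (\<rho> 1 \<otimes>\<^bsub>G\<^esub> \<rho> 2)"
      using st k c pow_ord_eq_1 by (metis T_def m_closed)+
    \<comment> \<open>The string property makes the third product square to the identity, so every
      pair of generators is covered.\<close>
    have "(\<rho> 0 \<otimes>\<^bsub>G\<^esub> \<rho> 2) \<otimes>\<^bsub>G\<^esub> (\<rho> 0 \<otimes>\<^bsub>G\<^esub> \<rho> 2)
      = (\<rho> 0 \<otimes>\<^bsub>G\<^esub> \<rho> 0) \<otimes>\<^bsub>G\<^esub> (\<rho> 2 \<otimes>\<^bsub>G\<^esub> \<rho> 2)"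
      using c string_property by (metis m_assoc m_closed)
    also have "\<dots> = \<one>\<^bsub>G\<^esub>" using invol by simp
    finally have "(\<rho> 0 \<otimes>\<^bsub>G\<^esub> \<rho> 2) [^]\<^bsub>G\<^esub> ((2::nat) ^ 1) = \<one>\<^bsub>G\<^esub>"
      using c by (simp add: numeral_2_eq_2)
    then have T02: "T (\<rho> 0 \<otimes>\<^bsub>G\<^esub> \<rho> 2)" unfolding T_def by blast
    \<comment> \<open>For involutions, y x is the inverse of x y.\<close>
    have swap: "T (y \<otimes>\<^bsub>G\<^esub> x)"
      if xy: "x \<in> \<rho> ` {0, 1, 2}" "y \<in> \<rho> ` {0, 1, 2}" and Txy: "T (x \<otimes>\<^bsub>G\<^esub> y)" for x y
    proof -
      have xyc: "x \<in> carrier G" "y \<in> carrier G" using xy gens_closed by auto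
      then have "inv\<^bsub>G\<^esub> x = x" "inv\<^bsub>G\<^esub> y = y" using xy invol by (simp_all add: inv_equality)
      then have "y \<otimes>\<^bsub>G\<^esub> x = inv\<^bsub>G\<^esub> (x \<otimes>\<^bsub>G\<^esub> y)" using xyc by (simp add: inv_mult_group)
      then show ?thesis using Txy xyc by (auto simp: T_def nat_pow_inv)
    qed
    have sq: "T (x \<otimes>\<^bsub>G\<^esub> x)" if "x \<in> \<rho> ` {0, 1, 2}" for x
      using invol[OF that] by (simp add: T_def)
    have "T (x \<otimes>\<^bsub>G\<^esub> y)" if "x \<in> \<rho> ` {0, 1, 2}" "y \<in> \<rho> ` {0, 1, 2}" for x y
      using that T01 T12 T02 swap sq by blast
    then show False
      using not_generated_by_involutions_of_two_power_products[OF assms(1,2,5) gens_closed invol]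
        gens_generate by (simp add: T_def)
  qed
  \<comment> \<open>The second case is the dual of Type (1): there the witnesses are
    \<open>a = k2\<close> and \<open>b = k1\<close>.\<close>
  with k_cases consider s t where "k1 = 2 ^ s * p" "k2 = 2 ^ t"
    | s t where "k1 = 2 ^ s" "k2 = 2 ^ t * p"
    | s t where "k1 = 2 ^ s * p" "k2 = 2 ^ t * p"
    by blast
  then show ?thesis by cases auto
qed

end
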